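(* Let $n, m, L, T$ be positive integers. Let $\Theta = \mathrm{conv}(\Omega) \subset \mathbb{R}^L$ be a nonempty compact polytope with $\Omega = \{\omega_v\}_{v=1}^{N_v}$. Let data $\mathbf{X}_- = [x(0), \ldots, x(T-1)] \in \mathbb{R}^{n \times T}$, $\mathbf{U} = [u(0), \ldots, u(T-1)] \in \mathbb{R}^{m \times T}$, $\mathbf{\Theta} = [\theta(0), \ldots, \theta(T-1)] \in \mathbb{R}^{L \times T}$ (with each $\theta(t) \in \Theta$), and one-step-ahead records $\mathbf{X}_\delta = \mathbf{X}_+ = [x(1), \ldots, x(T)] \in \mathbb{R}^{n \times T}$ be given, and let $\Phi \in \mathbb{S}^{n+T}$ be a given matrix, partitioned with $\Phi_{11} \in \mathbb{S}^n$ and $\Phi_{22} \in \mathbb{S}^T$, such that $-\Phi_{22} \in \mathbb{S}^T_+$. Let $\Sigma_{\mathcal{D}}(\Phi)$ be the set of plants consistent with the data and $\Psi$ the associated matrix, both defined in the context. Assume there is a ground-truth plant $(\{A_\ell^{\mathrm{true}}\}_{\ell=1}^L, B^{\mathrm{true}}) \in \Sigma_{\mathcal{D}}(\Phi)$. Fix an index $v \in \{1, \ldots, N_v\}$, a matrix $P \in \mathbb{S}^n_{++}$, and a matrix $K_v \in \mathbb{R}^{m \times n}$. Then the property $$[A_1, \ldots, A_L, B] \in \mathrm{SQBP}\begin{pmatrix} P & \mathbf{0} & \mathbf{0} \\ \mathbf{0} & -(\omega_v\omega_v^T)\otimes P & -\omega_v \otimes (P K_v^T) \\ \mathbf{0}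 & -\omega_v^T \otimes (K_v P) & -K_v P K_v^T\end{pmatrix}$$ holds for all $(\{A_\ell\}_{\ell=1}^L, B) \in \Sigma_{\mathcal{D}}(\Phi)$ if and only if there exist $\alpha_v \geq 0$ and $\beta_v > 0$ such that $$\begin{bmatrix} P - \beta_v I_n & \mathbf{0} & \mathbf{0} \\ \mathbf{0} & -(\omega_v\omega_v^T)\otimes P & -\omega_v \otimes (P K_v^T) \\ \mathbf{0} & -\omega_v^T \otimes (K_v P) & -K_v P K_v^T \end{bmatrix} - \alpha_v \Psi \in \mathbb{S}_+^{(L+1)n+m}.$$
   Context: Notation: $\mathbb{S}^k$, $\mathbb{S}^k_+$, $\mathbb{S}^k_{++}$ are the sets of real symmetric, positive semidefinite, and positive definite $k\times k$ matrices. $\otimes$ is the Kronecker product, $I_n$ the identity, $\mathbf{0}$ a zero matrix of appropriate size, $\mathrm{conv}$ the convex hull. Each $\omega_v$ is a column vector in $\mathbb{R}^L$. The block partition in the claim has block sizes $n$, $Ln$, $m$. Quadratic boundedness. Let $M \in \mathbb{S}^{n+k}$ be partitioned as $M = \begin{bmatrix} M_{11} & M_{12} \\ M_{12}^T & M_{22}\end{bmatrix}$ with $M_{11} \in \mathbb{S}^n$ and $-M_{22} \in \mathbb{S}^k_+$. A matrix $Z \in \mathbb{R}^{n\times k}$ satisfies $Z \in \mathrm{QBP}(M)$ if $$\begin{bmatrix} I_n \\ Z^T \end{bmatrix}^T M \begin{bmatrix} I_n \\ Z^T \end{bmatrix} \in \mathbb{S}^n_+,$$ and $Z \in \mathrm{SQBP}(M)$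 if this $n \times n$ matrix lies in $\mathbb{S}^n_{++}$. In the claim, $Z = [A_1,\ldots,A_L,B] \in \mathbb{R}^{n\times(Ln+m)}$, so $k = Ln+m$. System and consistency set. The data are recorded from an unknown discrete-time linear parameter-varying system $x(t+1) = \left(\sum_{\ell=1}^L \theta_\ell(t) A_\ell\right)x(t) + B u(t) + w(t)$ with $A_\ell \in \mathbb{R}^{n\times n}$, $B \in \mathbb{R}^{n\times m}$ and bounded discrepancy $w$. For a plant $(\{A_\ell\}_{\ell=1}^L, B)$, the discrepancy matrix is $\mathbf{W} = [w(0),\ldots,w(T-1)] \in \mathbb{R}^{n\times T}$ with columns $$w(t) = x(t+1) - \sum_{\ell=1}^L \theta_\ell(t) A_\ell x(t) - B u(t), \qquad t = 0, \ldots, T-1.$$ The consistency set is $\Sigma_{\mathcal{D}}(\Phi) = \{(\{A_\ell\}_{\ell=1}^L, B) : \mathbf{W} \in \mathrm{QBP}(\Phi)\}$. The matrix $\Psi$. Let $\mathbf{\Theta} * \mathbf{X}_- \in \mathbb{R}^{Ln\times T}$ denote the column-wise Khatri-Rao product, i.e. the matrix whose columns are $\theta(t)\otimes x(t)$, $t=0,\ldots,T-1$. Then $$\Psi = G\,\Phi\,G^T \in \mathbb{S}^{n+(Ln+m)}, \qquad G = \begin{bmatrix} I_n & \mathbf{X}_\delta \\ \mathbf{0}_{Ln\times n} & -\mathbf{\Theta} * \mathbf{X}_- \\ \mathbf{0}_{m\times n} & -\mathbf{U} \end{bmatrix}.$$ *)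

theory Defs
  imports "HOL-Analysis.Analysis"
begin

text \<open>
  Dimensions are the cardinalities of finite index types: \<open>'n\<close>, \<open>'m\<close>, \<open>'l\<close>, \<open>'t\<close> stand for
  $n$, $m$, $L$, $T$.  Block matrices are indexed by sum types, Kronecker products by product
  types, the first component being the (major) index of the left factor.
\<close>

definition sym_mats :: "(real^'k^'k) set" where
  "sym_mats = {M. transpose M = M}"

definition psd_mats :: "(real^'k^'k) set" where
  "psd_mats = {M \<in> sym_mats. \<forall>x. 0 \<le> x \<bullet> (M *v x)}"

definition pd_mats :: "(real^'k^'k) set" where
  "pd_mats = {M \<in> sym_mats. \<forall>x. x \<noteq> 0 \<longrightarrow> 0 < x \<bullet> (M *v x)}"

definition hcat :: "real^'c^'r \<Rightarrow> real^'d^'r \<Rightarrow> real^('c + 'd)^'r" where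
  "hcat A B = (\<chi> i j. case j of Inl c \<Rightarrow> A $ i $ c | Inr d \<Rightarrow> B $ i $ d)"

definition vcat :: "real^'c^'r \<Rightarrow> real^'c^'s \<Rightarrow> real^'c^('r + 's)" where
  "vcat A B = (\<chi> i. case i of Inl r \<Rightarrow> A $ r | Inr s \<Rightarrow> B $ s)"

definition block3 ::
  "real^'a^'a \<Rightarrow> real^'b^'a \<Rightarrow> real^'c^'a \<Rightarrow>
   real^'a^'b \<Rightarrow> real^'b^'b \<Rightarrow> real^'c^'b \<Rightarrow>
   real^'a^'c \<Rightarrow> real^'b^'c \<Rightarrow> real^'c^'c \<Rightarrow>
   real^('a + ('b + 'c))^('a + ('b + 'c))" where
  "block3 M11 M12 M13 M21 M22 M23 M31 M32 M33 =
     vcat (hcat M11 (hcat M12 M13))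
    (vcat (hcat M21 (hcat M22 M23))
          (hcat M31 (hcat M32 M33)))"

definition block22 :: "real^('a::finite + 'b::finite)^('a + 'b) \<Rightarrow> real^'b^'b" where
  "block22 M = (\<chi> i j. M $ Inr i $ Inr j)"

definition kron :: "real^'b^'a \<Rightarrow> real^'d^'c \<Rightarrow> real^('b \<times> 'd)^('a \<times> 'c)" where
  "kron A B = (\<chi> i j. A $ fst i $ fst j * B $ snd i $ snd j)"

text \<open>
  The Kronecker product of a column vector, respectively a row vector, with a matrix, and of two
  column vectors.  These are the instances of \<^const>\<open>kron\<close> in which an index of a one-column or
  one-row factor is trivial and is dropped from the index type.
\<close>

definition kron_col :: "real^'a \<Rightarrow> real^'d^'c \<Rightarrow> real^'d^('a \<times> 'c)" where
  "kron_col w B = (\<chi> i j. w $ fst i * B $ snd i $ j)"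

definition kron_row :: "real^'b \<Rightarrow> real^'d^'c \<Rightarrow> real^('b \<times> 'd)^'c" where
  "kron_row w B = (\<chi> i j. w $ fst j * B $ i $ snd j)"

definition kron_vec :: "real^'a \<Rightarrow> real^'c \<Rightarrow> real^('a \<times> 'c)" where
  "kron_vec w x = (\<chi> i. w $ fst i * x $ snd i)"

definition outer :: "real^'a \<Rightarrow> real^'a^'a" where
  "outer w = (columnvector w :: real^1^'a) ** rowvector w"

text \<open>
  Quadratic boundedness of $Z$.  The requirement that the matrix \<open>M\<close> be symmetric with negative
  semidefinite lower right block is a standing assumption on \<open>M\<close>, not on $Z$.
\<close>

definition QBP :: "real^('n + 'k)^('n + 'k) \<Rightarrow> (real^'k^'n) set" where
  "QBP M = {Z. transpose (vcat (mat 1) (transpose Z)) ** M ** vcat (mat 1) (transpose Z)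
                 \<in> psd_mats}"

definition SQBP :: "real^('n + 'k)^('n + 'k) \<Rightarrow> (real^'k^'n) set" where
  "SQBP M = {Z. transpose (vcat (mat 1) (transpose Z)) ** M ** vcat (mat 1) (transpose Z)
                 \<in> pd_mats}"

text \<open>
  Signals are functions of time, of which only the samples at $0, \dots, T$ matter.  The column
  index type \<open>'t\<close> of a data matrix is identified with $\{0, \dots, T-1\}$ through a labelling
  \<open>\<tau>\<close>, assumed bijective where it is used; column \<open>s\<close> holds the sample at time \<open>\<tau> s\<close>.
\<close>

definition data_mat :: "('t \<Rightarrow> nat) \<Rightarrow> (nat \<Rightarrow> real^'r) \<Rightarrow> real^'t^'r" where
  "data_mat \<tau> f = (\<chi> i s. f (\<tau> s) $ i)"

definition plant_row :: "('l::finite \<Rightarrow> real^'n^'n) \<Rightarrow> real^'m^'n \<Rightarrow> real^(('l \<times> 'n) + 'm)^'n" where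
  "plant_row A B = hcat (\<chi> i j. A (fst j) $ i $ snd j) B"

definition discrepancy ::
  "(nat \<Rightarrow> real^'n) \<Rightarrow> (nat \<Rightarrow> real^'m) \<Rightarrow> (nat \<Rightarrow> real^'l) \<Rightarrow>
   ('l \<Rightarrow> real^'n^'n) \<Rightarrow> real^'m^'n \<Rightarrow> nat \<Rightarrow> real^'n" where
  "discrepancy x u \<theta> A B t =
     x (t + 1) - (\<Sum>l\<in>UNIV. \<theta> t $ l *\<^sub>R (A l *v x t)) - B *v u t"

definition consistent_plants ::
  "('t::finite \<Rightarrow> nat) \<Rightarrow> (nat \<Rightarrow> real^'n) \<Rightarrow> (nat \<Rightarrow> real^'m) \<Rightarrow> (nat \<Rightarrow> real^'l) \<Rightarrow>
   real^('n + 't)^('n + 't) \<Rightarrow> (('l \<Rightarrow> real^'n^'n) \<times> (real^'m^'n)) set" where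
  "consistent_plants \<tau> x u \<theta> \<Phi> = {(A, B). data_mat \<tau> (discrepancy x u \<theta> A B) \<in> QBP \<Phi>}"

definition khatri_rao :: "real^'t^'a \<Rightarrow> real^'t^'c \<Rightarrow> real^'t^('a \<times> 'c)" where
  "khatri_rao X Y = transpose (\<chi> s. kron_vec (column s X) (column s Y))"

definition data_G ::
  "('t::finite \<Rightarrow> nat) \<Rightarrow> (nat \<Rightarrow> real^'n) \<Rightarrow> (nat \<Rightarrow> real^'m) \<Rightarrow> (nat \<Rightarrow> real^'l) \<Rightarrow>
   real^('n + 't)^('n + (('l \<times> 'n) + 'm))" where
  "data_G \<tau> x u \<theta> =
     vcat (hcat (mat 1) (data_mat \<tau> (\<lambda>t. x (t + 1))))
    (vcat (hcat 0 (- khatri_rao (data_mat \<tau> \<theta>) (data_mat \<tau> x)))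
          (hcat 0 (- data_mat \<tau> u)))"

definition data_Psi ::
  "('t::finite \<Rightarrow> nat) \<Rightarrow> (nat \<Rightarrow> real^'n) \<Rightarrow> (nat \<Rightarrow> real^'m) \<Rightarrow> (nat \<Rightarrow> real^'l) \<Rightarrow>
   real^('n + 't)^('n + 't) \<Rightarrow> real^('n + (('l \<times> 'n) + 'm))^('n + (('l \<times> 'n) + 'm))" where
  "data_Psi \<tau> x u \<theta> \<Phi> = data_G \<tau> x u \<theta> ** \<Phi> ** transpose (data_G \<tau> x u \<theta>)"

end

theory Submission
  imports Defs
begin

text \<open>
  Write $Z = [A_1, \dots, A_L, B]$.  The discrepancy matrix of the plant is the affine function
  $X_\delta - Z D$ of $Z$, where $D$ stacks the regressors $\Theta * X_-$ and $U$.  Hence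
  $[I \; W] = [I \; Z]\, G$, consistency with the data is exactly $Z \in \mathrm{QBP}(\Psi)$
  (\<open>QBP_congruence_iff\<close>), and every $Z$ comes from a plant.  Moreover, the matrix that
  expresses the desired property is block diagonal, with blocks $P$ and $-S$ for the positive
  semidefinite $S = C P C^T$, where $C$ stacks $\omega_v \otimes I$ and $K_v$
  (\<open>kron_blocks_eq_congruence\<close>).  So the claim is a strict matrix S-lemma: the inclusion
  $\mathrm{QBP}(N) \subseteq \mathrm{SQBP}(\mathrm{diag}(P, -S))$ is certified by multipliers
  (\<open>strict_matrix_S_lemma\<close>).

  Sufficiency of the multipliers is immediate.  For necessity, write $q_N(\xi, \eta)$ for the
  quadratic form of $N$; then $Z \in \mathrm{QBP}(N)$ means $q_N(\xi, Z^T \xi) \ge 0$ for all $\xi$.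

  Suppose first that $\ker N_{22} \subseteq \ker N_{12}$.  Completing the square shows that every
  $(\xi, \eta)$ with $\xi \ne 0$ and $q_N(\xi, \eta) \ge 0$ has the form $\eta = Z^T \xi$ for some
  $Z \in \mathrm{QBP}(N)$ (\<open>QBP_interpolation\<close>).  The inclusion thus becomes an implication between
  two scalar quadratic forms on the vectors $(\xi, \eta)$ with $\eta \perp \ker N_{22}$, and the
  strict S-lemma on a subspace (\<open>strict_S_lemma_on_subspace\<close>) provides $\alpha$; compactness of
  the unit sphere provides $\beta$.  The directions in $\ker N_{22}$ do not change $q_N$, and they
  are also invisible to $S$: along them $\mathrm{QBP}(N)$ contains full lines, whereas membership in
  $\mathrm{SQBP}$ keeps $Z S Z^T$ below $P$.

  Suppose now that $N_{22} z = 0$ but $N_{12} z \ne 0$ for some $z$.  The form $-\alpha q_N$ is then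
  unbounded below on the vectors $(\xi, t z)$ for every $\alpha > 0$, so only $\alpha = 0$ can be a
  multiplier and the inclusion has to force $S = 0$.  It does: $\mathrm{QBP}(N)$ then contains
  unbounded curves, and suitable ones exhaust all directions of $S$
  (\<open>degenerate_kernel_imp_zero\<close>).  Hence $\alpha = 0$ works, with $\beta$ a lower bound for the
  positive definite $P$.
\<close>

section \<open>The strict S-lemma for two quadratic forms on a subspace\<close>

lemma continuous_on_quadratic_form [continuous_intros]:
  fixes M :: "real^'k^'k"
  assumes "continuous_on U f"
  shows "continuous_on U (\<lambda>y. f y \<bullet> (M *v f y))"
  by (intro continuous_on_inner assms
      bounded_linear.continuous_on[OF matrix_vector_mul_bounded_linear])

lemma quadratic_form_scaleR:
  fixes M :: "real^'k^'k"
  shows "(c *\<^sub>R v) \<bullet> (M *v (c *\<^sub>R v)) = c\<^sup>2 * (v \<bullet> (M *v v))"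
  by (simp add: matrix_vector_mult_scaleR power2_eq_square)

lemma quadratic_form_comb:
  fixes M :: "real^'k^'k"
  shows "(a *\<^sub>R v + b *\<^sub>R w) \<bullet> (M *v (a *\<^sub>R v + b *\<^sub>R w)) =
    a\<^sup>2 * (v \<bullet> (M *v v)) + a * b * (v \<bullet> (M *v w) + w \<bullet> (M *v v)) + b\<^sup>2 * (w \<bullet> (M *v w))"
  by (simp add: matrix_vector_mult_scaleR matrix_vector_right_distrib inner_add_left inner_add_right
      power2_eq_square algebra_simps)

lemma pos_def_on_subspace_bound:
  fixes M :: "real^'k^'k"
  assumes V: "subspace V" and pos: "\<And>v. v \<in> V \<Longrightarrow> v \<noteq> 0 \<Longrightarrow> 0 < v \<bullet> (M *v v)"
  obtains \<beta> where "\<beta> > 0" "\<And>v. v \<in> V \<Longrightarrow> \<beta> * (v \<bullet> v) \<le> v \<bullet> (M *v v)"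
proof (cases "V \<inter> sphere 0 1 = {}")
  case True
  have "v = 0" if "v \<in> V" for v
  proof (rule ccontr)
    assume "v \<noteq> 0"
    then have "(1 / norm v) *\<^sub>R v \<in> V \<inter> sphere 0 1"
      using that V by (simp add: subspace_scale)
    with True show False by blast
  qed
  then show ?thesis by (intro that[of 1]) fastforce+
next
  case False
  have "compact (V \<inter> sphere 0 1)"
    using closed_subspace[OF V] by (simp add: closed_Int_compact)
  then obtain w where w: "w \<in> V \<inter> sphere 0 1"
    and min: "\<And>v. v \<in> V \<inter> sphere 0 1 \<Longrightarrow> w \<bullet> (M *v w) \<le> v \<bullet> (M *v v)"
    using continuous_attains_inf[OF _ False, of "\<lambda>v. v \<bullet> (M *v v)"]
      continuous_on_quadratic_form[OF continuous_on_id] by blast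
  show ?thesis
  proof (rule that)
    show "0 < w \<bullet> (M *v w)"
      using w pos[of w] by (cases "w = 0") auto
    fix v assume v: "v \<in> V"
    show "w \<bullet> (M *v w) * (v \<bullet> v) \<le> v \<bullet> (M *v v)"
    proof (cases "v = 0")
      case False
      then have "(1 / norm v) *\<^sub>R v \<in> V \<inter> sphere 0 1"
        using v V by (simp add: subspace_scale)
      from min[OF this] have "w \<bullet> (M *v w) \<le> (1 / norm v)\<^sup>2 * (v \<bullet> (M *v v))"
        by (simp only: quadratic_form_scaleR)
      then show ?thesis
        using False by (simp add: field_simps power2_norm_eq_inner)
    qed simp
  qed
qed

text \<open>
  By continuity the form of $N$ vanishes somewhere on the segment from $v$ to $w$.  Replacing $w$ by
  $-w$ does not change the forms at the endpoints but lets one choose the sign of the cross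
  term of $F$, and with a nonpositive cross term the form of $F$ stays nonpositive on the segment.
\<close>

lemma common_zero_between:
  fixes F N :: "real^'k^'k"
  assumes V: "subspace V" "v \<in> V" "w \<in> V"
    and F: "v \<bullet> (F *v v) \<le> 0" "w \<bullet> (F *v w) \<le> 0"
    and N: "0 \<le> v \<bullet> (N *v v)" "w \<bullet> (N *v w) \<le> 0"
    and nz: "v \<noteq> 0" "w \<noteq> 0"
  obtains z where "z \<in> V" "z \<noteq> 0" "z \<bullet> (N *v z) = 0" "z \<bullet> (F *v z) \<le> 0"
proof -
  obtain w' where w': "w' \<in> V" "w' \<noteq> 0" "w' \<bullet> (F *v w') \<le> 0" "w' \<bullet> (N *v w') \<le> 0"
    and cross: "v \<bullet> (F *v w') + w' \<bullet> (F *v v) \<le> 0"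
  proof (cases "v \<bullet> (F *v w) + w \<bullet> (F *v v) \<le> 0")
    case True
    then show ?thesis using that[of w] V F N nz by auto
  next
    case False
    have [simp]: "M *v (- w) = - (M *v w)" for M :: "real^'k^'k"
      using matrix_vector_mult_scaleR[of M "-1" w] by simp
    show ?thesis
      using that[of "- w"] V F N nz False by (auto simp: subspace_neg)
  qed
  define c where "c t = (1 - t) *\<^sub>R v + t *\<^sub>R w'" for t :: real
  have cV: "c t \<in> V" for t
    using V w' by (simp add: c_def subspace_add subspace_scale)
  have "\<exists>t\<ge>0. t \<le> 1 \<and> c t \<bullet> (N *v c t) = 0"
    by (rule IVT2') (use N w' in \<open>auto simp: c_def intro!: continuous_intros\<close>)
  then obtain t where t: "0 \<le> t" "t \<le> 1" "c t \<bullet> (N *v c t) = 0" by blast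
  have "c t \<bullet> (F *v c t) \<le> 0"
  proof -
    have "(1 - t)\<^sup>2 * (v \<bullet> (F *v v)) \<le> 0" "t\<^sup>2 * (w' \<bullet> (F *v w')) \<le> 0"
      using F w' by (auto intro: mult_nonneg_nonpos)
    moreover have "(1 - t) * t * (v \<bullet> (F *v w') + w' \<bullet> (F *v v)) \<le> 0"
      using t cross by (intro mult_nonneg_nonpos) auto
    ultimately show ?thesis
      unfolding c_def quadratic_form_comb by linarith
  qed
  show ?thesis
  proof (cases "c t = 0")
    case False
    then show ?thesis using that cV t \<open>c t \<bullet> (F *v c t) \<le> 0\<close> by blast
  next
    case True
    \<comment> \<open>The segment passes through the origin, so its endpoints are proportional.\<close>
    then have eq: "(1 - t) *\<^sub>R v = (- t) *\<^sub>R w'"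
      by (simp add: c_def add_eq_0_iff)
    have "t \<noteq> 1" using eq w' by auto
    have "(1 - t)\<^sup>2 * (v \<bullet> (N *v v)) = (- t)\<^sup>2 * (w' \<bullet> (N *v w'))"
      using arg_cong[OF eq, of "\<lambda>y. y \<bullet> (N *v y)"] by (simp only: quadratic_form_scaleR)
    also have "\<dots> \<le> 0" using w' by (intro mult_nonneg_nonpos) auto
    finally have "v \<bullet> (N *v v) \<le> 0"
      using \<open>t \<noteq> 1\<close> by (simp add: mult_le_0_iff) 
    then show ?thesis using that[of v] V F N nz by auto
  qed
qed

text \<open>
  A multiplier $\alpha \ge 0$ fails if the form of $M - \alpha N$ is nonpositive at some unit vector
  $v$ of $V$.  The failing multipliers form two closed sets, according to the sign of the form of $N$
  at $v$.  The sets are disjoint, since a common element would give, by \<open>common_zero_between\<close>, a nonzero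
  vector at which the form of $N$ is zero and that of $M$ is nonpositive.  If all $\alpha \ge 0$ failed,
  connectedness of $[0, \infty)$ would put them all into the set that contains $0$, but that set is
  bounded: unit vectors witnessing arbitrarily large multipliers accumulate at a vector that violates
  the assumption.
\<close>

theorem strict_S_lemma_on_subspace:
  fixes M N :: "real^'k^'k"
  assumes V: "subspace V"
    and imp: "\<And>v. v \<in> V \<Longrightarrow> v \<noteq> 0 \<Longrightarrow> 0 \<le> v \<bullet> (N *v v) \<Longrightarrow> 0 < v \<bullet> (M *v v)"
  obtains \<alpha> where "\<alpha> \<ge> 0" "\<And>v. v \<in> V \<Longrightarrow> v \<noteq> 0 \<Longrightarrow> 0 < v \<bullet> ((M - \<alpha> *\<^sub>R N) *v v)"
proof -
  have form: "v \<bullet> ((M - \<alpha> *\<^sub>R N) *v v) = v \<bullet> (M *v v) - \<alpha> * (v \<bullet> (N *v v))" for \<alpha> v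
    by (simp add: matrix_vector_mult_diff_rdistrib scaleR_matrix_vector_assoc[symmetric] inner_diff_right)
  define K where "K = V \<inter> sphere 0 1"
  have K: "compact K" "\<And>v. v \<in> K \<Longrightarrow> v \<noteq> 0 \<and> v \<in> V"
    using closed_subspace[OF V] by (auto simp: K_def closed_Int_compact)
  define A1 where "A1 = {\<alpha>. \<exists>v. v \<in> K \<and> (v, \<alpha>) \<in>
      {p. fst p \<bullet> (M *v fst p) - snd p * (fst p \<bullet> (N *v fst p)) \<le> 0 \<and> 0 \<le> fst p \<bullet> (N *v fst p)}}"
  define A2 where "A2 = {\<alpha>. \<exists>v. v \<in> K \<and> (v, \<alpha>) \<in>
      {p. fst p \<bullet> (M *v fst p) - snd p * (fst p \<bullet> (N *v fst p)) \<le> 0 \<and> fst p \<bullet> (N *v fst p) \<le> 0}}"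
  have closed: "closed A1" "closed A2"
    unfolding A1_def A2_def
    by (intro closed_compact_projection K closed_Collect_conj closed_Collect_le continuous_intros)+
  have disj: "A1 \<inter> A2 = {}"
  proof (rule ccontr)
    assume "A1 \<inter> A2 \<noteq> {}"
    then obtain \<alpha> v w where "v \<in> K" "w \<in> K"
      and "v \<bullet> ((M - \<alpha> *\<^sub>R N) *v v) \<le> 0" "w \<bullet> ((M - \<alpha> *\<^sub>R N) *v w) \<le> 0"
      and "0 \<le> v \<bullet> (N *v v)" "w \<bullet> (N *v w) \<le> 0"
      unfolding form by (auto simp: A1_def A2_def)
    then obtain z where "z \<in> V" "z \<noteq> 0" "z \<bullet> (N *v z) = 0" "z \<bullet> ((M - \<alpha> *\<^sub>R N) *v z) \<le> 0"
      using common_zero_between[OF V, of v w "M - \<alpha> *\<^sub>R N" N] K(2) by metis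
    then show False using imp[of z] by (simp add: form)
  qed
  have "\<exists>\<alpha>\<ge>0. \<alpha> \<notin> A1 \<union> A2"
  proof (rule ccontr)
    assume "\<not> ?thesis"
    then have cover: "{0..} \<subseteq> A1 \<union> A2" by auto
    have "0 \<notin> A1"
      using imp K(2) by (force simp: A1_def)
    then have "0 \<in> A2" using cover by auto
    then have "A1 \<inter> {0..} = {}"
      using connected_closedD[OF connected_Ici[of "0::real"], of A1 A2] closed disj cover by auto
    then have in_A2: "\<alpha> \<in> A2" if "\<alpha> \<ge> 0" for \<alpha>
      using cover that by auto
    \<comment> \<open>Unit vectors in \<open>A2\<close> for multipliers tending to infinity accumulate at a counterexample.\<close>
    have "\<forall>j. \<exists>v\<in>K. v \<bullet> (M *v v) - real j * (v \<bullet> (N *v v)) \<le> 0 \<and> v \<bullet> (N *v v) \<le> 0"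
    proof
      fix j show "\<exists>v\<in>K. v \<bullet> (M *v v) - real j * (v \<bullet> (N *v v)) \<le> 0 \<and> v \<bullet> (N *v v) \<le> 0"
        using in_A2[of "real j"] by (auto simp: A2_def)
    qed
    then obtain f where f: "\<And>j. f j \<in> K"
      "\<And>j. f j \<bullet> (M *v f j) - real j * (f j \<bullet> (N *v f j)) \<le> 0" "\<And>j. f j \<bullet> (N *v f j) \<le> 0"
      by metis
    obtain w r where w: "w \<in> K" "strict_mono r" "(f \<circ> r) \<longlonglongrightarrow> w"
      using K(1) f(1) unfolding compact_def by blast
    have lim: "(\<lambda>j. f (r j) \<bullet> (L *v f (r j))) \<longlonglongrightarrow> w \<bullet> (L *v w)" for L :: "real^'k^'k"
      using w(3) unfolding comp_def
      by (intro tendsto_inner bounded_linear.tendsto[OF matrix_vector_mul_bounded_linear])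
    have "w \<bullet> (M *v w) \<le> 0"
    proof (rule LIMSEQ_le_const2[OF lim], intro exI allI impI)
      fix j show "f (r j) \<bullet> (M *v f (r j)) \<le> 0"
        using f(2)[of "r j"] f(3)[of "r j"] mult_nonneg_nonpos[of "real (r j)" "f (r j) \<bullet> (N *v f (r j))"]
        by auto
    qed
    moreover have "0 \<le> w \<bullet> (N *v w)"
    proof -
      have low: "(\<lambda>j. f (r j) \<bullet> (M *v f (r j)) * inverse (real (r j))) \<longlonglongrightarrow> w \<bullet> (M *v w) * 0"
        by (intro tendsto_mult lim filterlim_compose[OF lim_inverse_n] 
            filterlim_subseq w)
      have le: "\<exists>j0. \<forall>j\<ge>j0. f (r j) \<bullet> (M *v f (r j)) * inverse (real (r j)) \<le> f (r j) \<bullet> (N *v f (r j))"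
      proof (intro exI allI impI)
        fix j :: nat assume "1 \<le> j"
        then have "real (r j) > 0" using seq_suble[OF w(2), of j] by simp
        then show "f (r j) \<bullet> (M *v f (r j)) * inverse (real (r j)) \<le> f (r j) \<bullet> (N *v f (r j))"
          using f(2)[of "r j"] by (simp add: field_simps)
      qed
      show ?thesis using LIMSEQ_le[OF low lim le] by simp
    qed
    ultimately show False using imp[of w] K(2)[OF w(1)] by simp
  qed
  then obtain \<alpha> where \<alpha>: "\<alpha> \<ge> 0" "\<alpha> \<notin> A1 \<union> A2" by blast
  show ?thesis
  proof (rule that[OF \<alpha>(1)])
    fix v assume v: "v \<in> V" "v \<noteq> 0"
    then have "(1 / norm v) *\<^sub>R v \<in> K"
      using V by (simp add: K_def subspace_scale)
    then have "0 < ((1 / norm v) *\<^sub>R v) \<bullet> ((M - \<alpha> *\<^sub>R N) *v ((1 / norm v) *\<^sub>R v))"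
      using \<alpha>(2) unfolding form A1_def A2_def
      by (smt (verit) UnI1 UnI2 fst_conv mem_Collect_eq snd_conv)
    then show "0 < v \<bullet> ((M - \<alpha> *\<^sub>R N) *v v)"
      unfolding quadratic_form_scaleR using v by (simp add: zero_less_mult_iff)
  qed
qed

section \<open>Positive semidefinite matrices\<close>

(* Keep A\<^sup>T x as it is, rather than in the row-vector form x v* A. *)
declare transpose_matrix_vector [simp del]

lemma inner_matrix_transpose:
  fixes A :: "real^'c^'r"
  shows "x \<bullet> (transpose A *v y) = (A *v x) \<bullet> y"
  by (metis dot_lmul_matrix inner_commute transpose_matrix_vector)

lemma sym_mats_inner: "A \<in> sym_mats \<Longrightarrow> x \<bullet> (A *v y) = (A *v x) \<bullet> y"
  using inner_matrix_transpose[of x A y] by (simp add: sym_mats_def)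

lemma uminus_matrix_vector [simp]: "(- A) *v x = - (A *v x)" for A :: "real^'c^'r"
  using matrix_vector_mult_diff_rdistrib[of 0 A x] by simp

lemma psd_kernel:
  assumes "E \<in> psd_mats" "x \<bullet> (E *v x) \<le> 0"
  shows "E *v x = 0"
proof (rule ccontr)
  assume "E *v x \<noteq> 0"
  define g where "g = (E *v x) \<bullet> (E *v x)"
  define q where "q = (E *v x) \<bullet> (E *v (E *v x))"
  have "g > 0" using \<open>E *v x \<noteq> 0\<close> by (simp add: g_def)
  have q: "q \<ge> 0" and sym: "E \<in> sym_mats" using assms by (auto simp: q_def psd_mats_def)
  have cross: "x \<bullet> (E *v (E *v x)) = g"
    using sym_mats_inner[OF sym] by (simp add: g_def)
  \<comment> \<open>Moving from \<open>x\<close> against its image by the step \<open>g / (q + 1)\<close> makes the form negative.\<close>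
  define s where "s = g / (q + 1)"
  have "s > 0" using \<open>g > 0\<close> q by (simp add: s_def)
  have "0 \<le> (1 *\<^sub>R x + (- s) *\<^sub>R (E *v x)) \<bullet> (E *v (1 *\<^sub>R x + (- s) *\<^sub>R (E *v x)))"
    using assms(1) unfolding psd_mats_def by blast
  also have "\<dots> = x \<bullet> (E *v x) - 2 * s * g + s\<^sup>2 * q"
    unfolding quadratic_form_comb using cross
    by (simp add: g_def[symmetric] q_def[symmetric])
  also have "\<dots> \<le> s * (s * q - 2 * g)"
    using assms(2) by (simp add: power2_eq_square algebra_simps)
  finally have "2 * g \<le> s * q" using \<open>s > 0\<close> by (simp add: zero_le_mult_iff)
  moreover have "s * q \<le> g"
    using q \<open>g > 0\<close> by (simp add: s_def field_simps)
  ultimately show False using \<open>g > 0\<close> by linarith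
qed

lemma psd_Cauchy_Schwarz:
  assumes "R \<in> psd_mats"
  shows "(x \<bullet> (R *v y))\<^sup>2 \<le> (x \<bullet> (R *v x)) * (y \<bullet> (R *v y))"
proof -
  define p q b where "p = x \<bullet> (R *v x)" and "q = y \<bullet> (R *v y)" and "b = x \<bullet> (R *v y)"
  have yx: "y \<bullet> (R *v x) = b"
    using assms sym_mats_inner[of R y x] by (simp add: psd_mats_def b_def inner_commute)
  have "0 \<le> q" using assms by (auto simp: psd_mats_def q_def)
  show ?thesis
  proof (cases "q = 0")
    case True
    then have "R *v y = 0" using psd_kernel[OF assms, of y] by (simp add: q_def)
    then show ?thesis by simp
  next
    case False
    have "0 \<le> (q *\<^sub>R x + (- b) *\<^sub>R y) \<bullet> (R *v (q *\<^sub>R x + (- b) *\<^sub>R y))"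
      using assms unfolding psd_mats_def by blast
    also have "\<dots> = q * (p * q - b\<^sup>2)"
      unfolding quadratic_form_comb p_def[symmetric] q_def[symmetric] yx unfolding b_def[symmetric]
      by (simp add: power2_eq_square algebra_simps)
    finally show ?thesis
      using False \<open>0 \<le> q\<close> by (simp add: zero_le_mult_iff p_def q_def b_def)
  qed
qed

text \<open>
  Along a ray the form of $S$ is a quadratic polynomial in the parameter whose leading
  coefficient is the value of the form at the direction; boundedness makes that value zero.
\<close>

lemma psd_bounded_ray:
  assumes S: "S \<in> psd_mats"
    and bound: "\<And>t. t \<ge> 0 \<Longrightarrow> (f + t *\<^sub>R g) \<bullet> (S *v (f + t *\<^sub>R g)) \<le> c"
  shows "S *v g = 0"
proof (rule psd_kernel[OF S], rule ccontr)
  define q b where "q = g \<bullet> (S *v g)" and "b = f \<bullet> (S *v g) + g \<bullet> (S *v f)"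
  assume "\<not> g \<bullet> (S *v g) \<le> 0"
  then have "q > 0" by (simp add: q_def)
  \<comment> \<open>At this time the quadratic polynomial in \<open>t\<close> is at least \<open>t * (\<bar>c\<bar> + 1)\<close> with \<open>t \<ge> 1\<close>.\<close>
  define t where "t = 1 + (\<bar>b\<bar> + \<bar>c\<bar> + 1) / q"
  have t: "t \<ge> 1" using \<open>q > 0\<close> by (simp add: t_def)
  define p where "p = t * q + b"
  have "t * q \<ge> \<bar>b\<bar> + \<bar>c\<bar> + 1" using \<open>q > 0\<close> by (simp add: t_def field_simps)
  then have p: "\<bar>c\<bar> + 1 \<le> p" by (simp add: p_def)
  then have "1 * p \<le> t * p" using t by (intro mult_right_mono) auto
  moreover have "f \<bullet> (S *v f) + t * p \<le> c"
    using bound[of t] t quadratic_form_comb[of 1 f t g S]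
    by (simp add: p_def q_def b_def power2_eq_square algebra_simps)
  moreover have "f \<bullet> (S *v f) \<ge> 0" using S by (auto simp: psd_mats_def)
  ultimately show False using p by simp
qed

section \<open>Block vectors and block matrices\<close>

definition vjoin :: "real^'a \<Rightarrow> real^'b \<Rightarrow> real^('a + 'b)" where
  "vjoin x y = (\<chi> i. case i of Inl a \<Rightarrow> x $ a | Inr b \<Rightarrow> y $ b)"

lemma vjoin_nth [simp]: "vjoin x y $ Inl a = x $ a" "vjoin x y $ Inr b = y $ b"
  by (simp_all add: vjoin_def)

lemma sum_UNIV_Plus:
  "(\<Sum>i\<in>(UNIV :: ('a::finite + 'b::finite) set). f i) = (\<Sum>a\<in>UNIV. f (Inl a)) + (\<Sum>b\<in>UNIV. f (Inr b))"
  using sum.Plus[of "UNIV :: 'a set" "UNIV :: 'b set" f] by (simp add: comp_def)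

lemma vec_eq_Plus_iff:
  fixes v w :: "'x^('a::finite + 'b::finite)"
  shows "v = w \<longleftrightarrow> (\<forall>a. v $ Inl a = w $ Inl a) \<and> (\<forall>b. v $ Inr b = w $ Inr b)"
  unfolding vec_eq_iff by (metis sum.exhaust)

lemma vjoin_exhaust: obtains x y where "v = vjoin x y"
proof
  show "v = vjoin (\<chi> a. v $ Inl a) (\<chi> b. v $ Inr b)" by (simp add: vec_eq_Plus_iff)
qed

lemma vjoin_inner [simp]: "vjoin a b \<bullet> vjoin c d = a \<bullet> c + b \<bullet> d"
  by (simp add: inner_vec_def sum_UNIV_Plus)

lemma vjoin_add: "vjoin a b + vjoin c d = vjoin (a + c) (b + d)"
  by (simp add: vec_eq_Plus_iff)

lemma vjoin_eq_0_iff [simp]: "vjoin a b = 0 \<longleftrightarrow> a = 0 \<and> b = 0"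
  by (simp add: vec_eq_Plus_iff) (simp add: vec_eq_iff)

lemma vcat_mult_vec [simp]: "vcat A B *v x = vjoin (A *v x) (B *v x)"
  by (simp add: vec_eq_Plus_iff matrix_vector_mult_def vcat_def)

lemma hcat_mult_vjoin [simp]: "hcat A B *v vjoin x y = A *v x + B *v y"
  by (simp add: vec_eq_iff matrix_vector_mult_def hcat_def sum_UNIV_Plus)

lemma transpose_vcat: "transpose (vcat A B) = hcat (transpose A) (transpose B)"
  by (simp add: vec_eq_iff transpose_def vcat_def hcat_def split: sum.split)

lemma transpose_hcat: "transpose (hcat A B) = vcat (transpose A) (transpose B)"
  by (simp add: vec_eq_iff transpose_def vcat_def hcat_def split: sum.split)

lemma transpose_congruence:
  fixes M :: "real^'r^'r" and X :: "real^'c^'r"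
  assumes "M \<in> sym_mats"
  shows "transpose X ** M ** X \<in> sym_mats"
  using assms by (simp add: sym_mats_def matrix_transpose_mul matrix_mul_assoc)

lemma quadratic_form_congruence:
  fixes M :: "real^'r^'r" and X :: "real^'c^'r"
  shows "x \<bullet> ((transpose X ** M ** X) *v x) = (X *v x) \<bullet> (M *v (X *v x))"
  by (simp add: matrix_vector_mul_assoc[symmetric] inner_matrix_transpose)

lemma QBP_iff:
  assumes "M \<in> sym_mats"
  shows "Z \<in> QBP M \<longleftrightarrow>
    (\<forall>\<xi>. 0 \<le> vjoin \<xi> (transpose Z *v \<xi>) \<bullet> (M *v vjoin \<xi> (transpose Z *v \<xi>)))"
  using transpose_congruence[OF assms, of "vcat (mat 1) (transpose Z)"]
  by (simp add: QBP_def psd_mats_def quadratic_form_congruence)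

lemma SQBP_iff:
  assumes "M \<in> sym_mats"
  shows "Z \<in> SQBP M \<longleftrightarrow>
    (\<forall>\<xi>. \<xi> \<noteq> 0 \<longrightarrow> 0 < vjoin \<xi> (transpose Z *v \<xi>) \<bullet> (M *v vjoin \<xi> (transpose Z *v \<xi>)))"
  using transpose_congruence[OF assms, of "vcat (mat 1) (transpose Z)"]
  by (simp add: SQBP_def pd_mats_def quadratic_form_congruence)

definition block11 :: "real^('a::finite + 'b::finite)^('a + 'b) \<Rightarrow> real^'a^'a" where
  "block11 M = (\<chi> i j. M $ Inl i $ Inl j)"

definition block12 :: "real^('a::finite + 'b::finite)^('a + 'b) \<Rightarrow> real^'b^'a" where
  "block12 M = (\<chi> i j. M $ Inl i $ Inr j)"

lemma sym_mats_mult_vjoin: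
  assumes "M \<in> sym_mats"
  shows "M *v vjoin x y = vjoin (block11 M *v x + block12 M *v y)
    (transpose (block12 M) *v x + block22 M *v y)"
proof -
  have "transpose M $ Inr i $ Inl j = M $ Inr i $ Inl j" for i j
    using assms by (simp add: sym_mats_def)
  then have "M $ Inr i $ Inl j = M $ Inl j $ Inr i" for i j
    by (simp add: transpose_def)
  then show ?thesis
    by (simp add: vec_eq_Plus_iff matrix_vector_mult_def sum_UNIV_Plus block11_def block12_def
        block22_def transpose_def)
qed

lemma sym_mats_block22: "M \<in> sym_mats \<Longrightarrow> block22 M \<in> sym_mats"
  by (simp add: sym_mats_def block22_def vec_eq_iff transpose_def)

lemma sym_mats_block11: "M \<in> sym_mats \<Longrightarrow> block11 M \<in> sym_mats"
  by (simp add: sym_mats_def block11_def vec_eq_iff transpose_def)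

lemma quadratic_form_vjoin:
  assumes "M \<in> sym_mats"
  shows "vjoin x y \<bullet> (M *v vjoin x y) =
    x \<bullet> (block11 M *v x) + 2 * (x \<bullet> (block12 M *v y)) + y \<bullet> (block22 M *v y)"
  by (simp add: sym_mats_mult_vjoin[OF assms] inner_add_right inner_matrix_transpose
      inner_commute[of "block12 M *v y" x])

definition block_diag :: "real^'a^'a \<Rightarrow> real^'b^'b \<Rightarrow> real^('a + 'b)^('a + 'b)" where
  "block_diag X Y = vcat (hcat X 0) (hcat 0 Y)"

lemma block_diag_mult_vjoin [simp]: "block_diag X Y *v vjoin x y = vjoin (X *v x) (Y *v y)"
  by (simp add: block_diag_def)

lemma sym_mats_block_diag: "X \<in> sym_mats \<Longrightarrow> Y \<in> sym_mats \<Longrightarrow> block_diag X Y \<in> sym_mats"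
  by (simp add: sym_mats_def block_diag_def vec_eq_iff transpose_def vcat_def hcat_def
      split: sum.split)

definition rank_one :: "real^'r \<Rightarrow> real^'c \<Rightarrow> real^'c^'r" where
  "rank_one a z = (\<chi> i j. a $ i * z $ j)"

lemma rank_one_transpose_mult [simp]: "transpose (rank_one a z) *v \<xi> = (a \<bullet> \<xi>) *\<^sub>R z"
  by (simp add: vec_eq_iff transpose_def rank_one_def matrix_vector_mult_def inner_vec_def
      sum_distrib_left mult_ac)

lemma transpose_add: "transpose (A + B) = transpose A + transpose B" for A B :: "real^'c^'r"
  by (simp add: vec_eq_iff transpose_def)

lemma transpose_scaleR: "transpose (r *\<^sub>R A) = r *\<^sub>R transpose A" for A :: "real^'c^'r"
  by (simp add: vec_eq_iff transpose_def)

lemma scaleR_matrix_vector: "(r *\<^sub>R A) *v x = r *\<^sub>R (A *v x)" for A :: "real^'c^'r"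
  by (simp add: scaleR_matrix_vector_assoc)

lemma psd_congruence:
  fixes C :: "real^'c^'r"
  assumes "P \<in> psd_mats"
  shows "C ** P ** transpose C \<in> psd_mats"
  using assms transpose_congruence[of P "transpose C"] quadratic_form_congruence[of _ "transpose C" P]
  by (simp add: psd_mats_def)

section \<open>The strict matrix S-lemma\<close>

text \<open>
  The rank-one matrix $Y = R \xi \eta^T / (\xi^T R \xi)$ maps as required, and the
  inequality is the Cauchy-Schwarz inequality for $R$.  If $\xi^T R \xi = 0$, then $\eta$ is in the
  kernel of $E$, and $Y = \xi \eta^T / (\xi^T \xi)$ does it.
\<close>

lemma psd_interpolation:
  fixes R :: "real^'n^'n" and E :: "real^'k^'k"
  assumes R: "R \<in> psd_mats" and E: "E \<in> psd_mats"
    and \<xi>: "\<xi> \<noteq> 0" and le: "\<eta> \<bullet> (E *v \<eta>) \<le> \<xi> \<bullet> (R *v \<xi>)"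
  obtains Y :: "real^'k^'n" where "transpose Y *v \<xi> = \<eta>"
    and "\<And>\<zeta>. (transpose Y *v \<zeta>) \<bullet> (E *v (transpose Y *v \<zeta>)) \<le> \<zeta> \<bullet> (R *v \<zeta>)"
proof (cases "\<xi> \<bullet> (R *v \<xi>) = 0")
  case True
  have "E *v \<eta> = 0" using psd_kernel[OF E] le True by simp
  then show ?thesis
    using that[of "rank_one ((1 / (\<xi> \<bullet> \<xi>)) *\<^sub>R \<xi>) \<eta>"] \<xi> R
    by (simp add: matrix_vector_mult_scaleR psd_mats_def)
next
  case False
  define r where "r = \<xi> \<bullet> (R *v \<xi>)"
  have r: "r > 0" using R False by (force simp: r_def psd_mats_def less_le)
  define Y where "Y = rank_one ((1 / r) *\<^sub>R (R *v \<xi>)) \<eta>"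
  have Y: "transpose Y *v \<zeta> = ((\<zeta> \<bullet> (R *v \<xi>)) / r) *\<^sub>R \<eta>" for \<zeta>
    by (simp add: Y_def inner_commute)
  show ?thesis
  proof (rule that)
    show "transpose Y *v \<xi> = \<eta>" using r by (simp add: Y r_def)
    fix \<zeta>
    have "((\<zeta> \<bullet> (R *v \<xi>)) / r)\<^sup>2 * (\<eta> \<bullet> (E *v \<eta>)) \<le> ((\<zeta> \<bullet> (R *v \<xi>)) / r)\<^sup>2 * r"
      using le by (intro mult_left_mono) (auto simp: r_def)
    also have "\<dots> = (\<zeta> \<bullet> (R *v \<xi>))\<^sup>2 / r"
      using r by (simp add: power2_eq_square)
    also have "\<dots> \<le> \<zeta> \<bullet> (R *v \<zeta>)"
      using psd_Cauchy_Schwarz[OF R, of \<zeta> \<xi>] r by (simp add: r_def field_simps)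
    finally show "(transpose Y *v \<zeta>) \<bullet> (E *v (transpose Y *v \<zeta>)) \<le> \<zeta> \<bullet> (R *v \<zeta>)"
      unfolding Y quadratic_form_scaleR .
  qed
qed

text \<open>
  The rows of $A$ are orthogonal to the kernel of $E$, hence lie in the range of the symmetric $E$.
\<close>

lemma matrix_factor_through_symmetric:
  fixes A :: "real^'k^'n" and E :: "real^'k^'k"
  assumes E: "E \<in> sym_mats" and ker: "\<And>z. E *v z = 0 \<Longrightarrow> A *v z = 0"
  obtains C :: "real^'k^'n" where "A = C ** E"
proof -
  have "\<exists>p. A $ i = E *v p" for i
  proof -
    have span: "span (range ((*v) E)) = range ((*v) E)"
      by (simp add: linear_subspace_image span_eq_iff)
    obtain y z where "y \<in> range ((*v) E)" and orth: "\<And>w. w \<in> range ((*v) E) \<Longrightarrow> orthogonal z w"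
      and A: "A $ i = y + z"
      using orthogonal_subspace_decomp_exists[of "range ((*v) E)" "A $ i"] unfolding span by blast
    have "(E *v z) \<bullet> (E *v z) = 0"
      using orth[of "E *v (E *v z)"] sym_mats_inner[OF E] by (simp add: orthogonal_def)
    then have "A *v z = 0" using ker by simp
    then have "(A $ i) \<bullet> z = 0"
      using matrix_vector_mul_component[of A z i] by simp
    moreover have "y \<bullet> z = 0"
      using orth[OF \<open>y \<in> _\<close>] by (simp add: orthogonal_def inner_commute)
    ultimately have "z = 0" using A by (simp add: inner_add_left)
    then show ?thesis using A \<open>y \<in> _\<close> by auto
  qed
  then obtain p where p: "\<And>i. A $ i = E *v p i" by metis
  have "A = (\<chi> i. p i) ** E"
  proof (unfold matrix_eq, intro allI)
    fix y show "A *v y = ((\<chi> i. p i) ** E) *v y"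
      by (simp add: vec_eq_iff matrix_vector_mul_component matrix_vector_mul_assoc[symmetric] p
          sym_mats_inner[OF E])
  qed
  then show ?thesis using that by blast
qed

text \<open>
  With $E = -N_{22}$ and $N_{12} = C E$, the form of $N$ is
  $\xi^T R\, \xi - (\eta - C^T \xi)^T E\, (\eta - C^T \xi)$.  So $Z = C + Y$ is in
  $\mathrm{QBP}(N)$ if and only if $Y E Y^T \le R$, and the interpolation problem for $Z$ is solved
  by \<open>psd_interpolation\<close>.  A member $Z_0$ of $\mathrm{QBP}(N)$ guarantees that $R$ is positive
  semidefinite.
\<close>

theorem QBP_interpolation:
  fixes N :: "real^('n::finite + 'k::finite)^('n + 'k)"
  assumes N: "N \<in> sym_mats" and N22: "- block22 N \<in> psd_mats"
    and ker: "\<And>z. block22 N *v z = 0 \<Longrightarrow> block12 N *v z = 0"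
    and Z0: "Z0 \<in> QBP N" and \<xi>: "\<xi> \<noteq> 0" and nonneg: "0 \<le> vjoin \<xi> \<eta> \<bullet> (N *v vjoin \<xi> \<eta>)"
  obtains Z where "Z \<in> QBP N" "transpose Z *v \<xi> = \<eta>"
proof -
  define E where "E = - block22 N"
  have E: "E \<in> psd_mats" "E \<in> sym_mats" using N22 by (auto simp: E_def psd_mats_def)
  obtain C where C: "block12 N = C ** E"
    using matrix_factor_through_symmetric[OF E(2), of "block12 N"] ker by (auto simp: E_def)
  define R where "R = block11 N + C ** E ** transpose C"
  have square: "vjoin \<zeta> y \<bullet> (N *v vjoin \<zeta> y) =
      \<zeta> \<bullet> (R *v \<zeta>) - (y - transpose C *v \<zeta>) \<bullet> (E *v (y - transpose C *v \<zeta>))" for \<zeta> y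
  proof -
    have mixed: "\<zeta> \<bullet> (C *v w) = (transpose C *v \<zeta>) \<bullet> w" for w
      using inner_matrix_transpose[of \<zeta> "transpose C" w] by simp
    have "block22 N = - E" by (simp add: E_def)
    moreover have "(transpose C *v \<zeta>) \<bullet> (E *v y) = y \<bullet> (E *v (transpose C *v \<zeta>))"
      using sym_mats_inner[OF E(2)] by (metis inner_commute)
    ultimately show ?thesis
      unfolding quadratic_form_vjoin[OF N] R_def C
      by (simp add: matrix_vector_mul_assoc[symmetric] matrix_vector_mult_add_rdistrib
          matrix_vector_mult_diff_distrib inner_add_right inner_diff_left inner_diff_right mixed)
  qed
  have "R \<in> sym_mats"
    using sym_mats_block11[OF N] transpose_congruence[OF E(2), of "transpose C"]
    by (simp add: R_def sym_mats_def transpose_add)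
  moreover have "0 \<le> \<zeta> \<bullet> (R *v \<zeta>)" for \<zeta>
  proof -
    define w where "w = transpose Z0 *v \<zeta> - transpose C *v \<zeta>"
    have "0 \<le> \<zeta> \<bullet> (R *v \<zeta>) - w \<bullet> (E *v w)"
      using Z0 unfolding QBP_iff[OF N] square w_def by blast
    moreover have "0 \<le> w \<bullet> (E *v w)" using E(1) by (simp add: psd_mats_def)
    ultimately show ?thesis by linarith
  qed
  ultimately have R: "R \<in> psd_mats" by (simp add: psd_mats_def)
  obtain Y where Y: "transpose Y *v \<xi> = \<eta> - transpose C *v \<xi>"
    "\<And>\<zeta>. (transpose Y *v \<zeta>) \<bullet> (E *v (transpose Y *v \<zeta>)) \<le> \<zeta> \<bullet> (R *v \<zeta>)"
    using psd_interpolation[OF R E(1) \<xi>, of "\<eta> - transpose C *v \<xi>"] nonneg unfolding square by auto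
  show ?thesis
  proof (rule that)
    show "C + Y \<in> QBP N"
      unfolding QBP_iff[OF N] square using Y(2)
      by (simp add: transpose_add matrix_vector_mult_add_rdistrib)
    show "transpose (C + Y) *v \<xi> = \<eta>"
      using Y(1) by (simp add: transpose_add matrix_vector_mult_add_rdistrib)
  qed
qed

lemma QBP_recession_of_common_kernel:
  fixes N :: "real^('n::finite + 'k::finite)^('n + 'k)"
  assumes N: "N \<in> sym_mats" and Z: "Z \<in> QBP N"
    and z: "block22 N *v z = 0" "block12 N *v z = 0"
  shows "Z + rank_one x z \<in> QBP N"
proof -
  have "z \<bullet> (block22 N *v w) = 0" for w
    using sym_mats_inner[OF sym_mats_block22[OF N], of z w] z by simp
  then show ?thesis
    using Z z unfolding QBP_iff[OF N] quadratic_form_vjoin[OF N]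
    by (simp add: transpose_add matrix_vector_mult_add_rdistrib matrix_vector_right_distrib
        matrix_vector_mult_scaleR inner_add_left inner_add_right)
qed

text \<open>
  Moving along $a y^T$ changes the form of $N$ by a cross term, with matrix $a b^T + b a^T$, and a
  possibly negative quadratic term along $a a^T$.  Since $N_{12} z = a$ and $N_{22} z = 0$, adding
  $c z^T$ changes it by $a c^T + c a^T$ only.  So the part $-t b$ of $c$ cancels the cross term, and
  the part $s a$ compensates the quadratic one.
\<close>

lemma QBP_recession_of_degenerate_kernel:
  fixes N :: "real^('n::finite + 'k::finite)^('n + 'k)"
  assumes N: "N \<in> sym_mats" and Z: "Z \<in> QBP N" and z: "block22 N *v z = 0"
    and a: "a = block12 N *v z" and b: "b = block12 N *v y + Z *v (block22 N *v y)"
    and s: "0 \<le> 2 * s + t\<^sup>2 * (y \<bullet> (block22 N *v y))"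
  shows "Z + t *\<^sub>R rank_one a y + rank_one (s *\<^sub>R a - t *\<^sub>R b) z \<in> QBP N"
  unfolding QBP_iff[OF N]
proof
  fix \<xi>
  let ?Z = "Z + t *\<^sub>R rank_one a y + rank_one (s *\<^sub>R a - t *\<^sub>R b) z"
  define w where "w = transpose Z *v \<xi>"
  define p q where "p = a \<bullet> \<xi>" and "q = b \<bullet> \<xi>"
  have Z': "transpose ?Z *v \<xi> = w + (t * p) *\<^sub>R y + (s * p - t * q) *\<^sub>R z"
    by (simp add: w_def p_def q_def transpose_add transpose_scaleR matrix_vector_mult_add_rdistrib
        scaleR_matrix_vector inner_diff_left)
  have kz: "z \<bullet> (block22 N *v v) = 0" for v
    using sym_mats_inner[OF sym_mats_block22[OF N], of z v] z by simp
  have yw: "y \<bullet> (block22 N *v w) = w \<bullet> (block22 N *v y)"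
    using sym_mats_inner[OF sym_mats_block22[OF N], of y w] by (simp add: inner_commute)
  have \<xi>z: "\<xi> \<bullet> (block12 N *v z) = p" by (simp add: a p_def inner_commute)
  have \<xi>y: "\<xi> \<bullet> (block12 N *v y) = q - w \<bullet> (block22 N *v y)"
    using inner_matrix_transpose[of \<xi> "transpose Z" "block22 N *v y"]
    by (simp add: b q_def w_def inner_add_left inner_add_right inner_commute)
  have "vjoin \<xi> (transpose ?Z *v \<xi>) \<bullet> (N *v vjoin \<xi> (transpose ?Z *v \<xi>))
      = vjoin \<xi> w \<bullet> (N *v vjoin \<xi> w) + p\<^sup>2 * (2 * s + t\<^sup>2 * (y \<bullet> (block22 N *v y)))"
    unfolding quadratic_form_vjoin[OF N] Z'
    by (simp add: matrix_vector_right_distrib matrix_vector_mult_scaleR inner_add_left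
        inner_add_right kz yw \<xi>z \<xi>y z) (simp add: power2_eq_square algebra_simps)
  moreover have "0 \<le> vjoin \<xi> w \<bullet> (N *v vjoin \<xi> w)"
    using Z unfolding QBP_iff[OF N] w_def by blast
  ultimately show "0 \<le> vjoin \<xi> (transpose ?Z *v \<xi>) \<bullet> (N *v vjoin \<xi> (transpose ?Z *v \<xi>))"
    using s by simp
qed

lemma SQBP_block_diag_iff:
  assumes "P \<in> sym_mats" "S \<in> sym_mats"
  shows "Z \<in> SQBP (block_diag P (- S)) \<longleftrightarrow>
    (\<forall>\<xi>. \<xi> \<noteq> 0 \<longrightarrow> (transpose Z *v \<xi>) \<bullet> (S *v (transpose Z *v \<xi>)) < \<xi> \<bullet> (P *v \<xi>))"
proof -
  have "block_diag P (- S) \<in> sym_mats"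
    using assms by (intro sym_mats_block_diag) (auto simp: sym_mats_def transpose_def vec_eq_iff)
  then show ?thesis by (simp add: SQBP_iff)
qed

text \<open>
  Membership in $\mathrm{SQBP}$ bounds $Z S Z^T$ by $P$, so along a ray inside $\mathrm{QBP}(N)$ the
  direction must be invisible to $S$.
\<close>

lemma QBP_ray_in_SQBP:
  assumes P: "P \<in> sym_mats" and S: "S \<in> psd_mats"
    and sub: "QBP N \<subseteq> SQBP (block_diag P (- S))"
    and "\<xi> \<noteq> 0"
    and ray: "\<And>t. t \<ge> 0 \<Longrightarrow> Z t \<in> QBP N"
    and Z: "\<And>t. transpose (Z t) *v \<xi> = f + t *\<^sub>R g"
  shows "S *v g = 0"
proof (rule psd_bounded_ray[OF S])
  fix t :: real assume "t \<ge> 0"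
  then have "Z t \<in> SQBP (block_diag P (- S))" using ray sub by blast
  then show "(f + t *\<^sub>R g) \<bullet> (S *v (f + t *\<^sub>R g)) \<le> \<xi> \<bullet> (P *v \<xi>)"
    using SQBP_block_diag_iff[OF P, of S] S \<open>\<xi> \<noteq> 0\<close> Z[of t]
    by (force simp: psd_mats_def)
qed

text \<open>
  The curves of \<open>QBP_recession_of_degenerate_kernel\<close> with $y = 0$ are rays in the direction
  $a z^T$, which gives $S z = 0$.  Modulo the directions in which the row factor is $z$, now invisible
  to $S$, the curves for general $y$ are lines in the direction $a y^T$, which gives $S y = 0$.
\<close>

lemma degenerate_kernel_imp_zero:
  fixes N :: "real^('n::finite + 'k::finite)^('n + 'k)"
  assumes N: "N \<in> sym_mats" and N22: "- block22 N \<in> psd_mats" and Z0: "Z0 \<in> QBP N"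
    and P: "P \<in> sym_mats" and S: "S \<in> psd_mats"
    and sub: "QBP N \<subseteq> SQBP (block_diag P (- S))"
    and z: "block22 N *v z = 0" "block12 N *v z \<noteq> 0"
  shows "S = 0"
proof -
  define a where "a = block12 N *v z"
  have a: "a \<noteq> 0" "a \<bullet> a \<noteq> 0" using z by (auto simp: a_def)
  have "S *v ((a \<bullet> a) *\<^sub>R z) = 0"
  proof (rule QBP_ray_in_SQBP[OF P S sub \<open>a \<noteq> 0\<close>])
    fix t :: real
    show "Z0 + rank_one (t *\<^sub>R a) z \<in> QBP N" if "t \<ge> 0"
      using QBP_recession_of_degenerate_kernel[OF N Z0 z(1) a_def refl, of t 0 0] that by simp
    show "transpose (Z0 + rank_one (t *\<^sub>R a) z) *v a = transpose Z0 *v a + t *\<^sub>R ((a \<bullet> a) *\<^sub>R z)"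
      by (simp add: transpose_add matrix_vector_mult_add_rdistrib)
  qed
  then have Sz: "S *v z = 0" using a by (simp add: matrix_vector_mult_scaleR)
  have zS: "z \<bullet> (S *v w) = 0" for w
    using sym_mats_inner[of S z w] S Sz by (simp add: psd_mats_def)
  have "S *v y = 0" for y
  proof -
    define b where "b = block12 N *v y + Z0 *v (block22 N *v y)"
    \<comment> \<open>This choice of \<open>s\<close> makes the quadratic compensation exact.\<close>
    define s where "s t = - (t\<^sup>2 * (y \<bullet> (block22 N *v y))) / 2" for t
    define Z where "Z t = Z0 + t *\<^sub>R rank_one a y + rank_one (s t *\<^sub>R a - t *\<^sub>R b) z" for t
    have ZQ: "Z t \<in> QBP N" for t
      unfolding Z_def
      by (rule QBP_recession_of_degenerate_kernel[OF N Z0 z(1) a_def b_def]) (simp add: s_def)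
    have "S *v ((a \<bullet> a) *\<^sub>R y) = 0"
    proof (rule psd_bounded_ray[OF S])
      fix t :: real
      define d where "d = s t * (a \<bullet> a) - t * (b \<bullet> a)"
      have "transpose (Z t) *v a = transpose Z0 *v a + t *\<^sub>R ((a \<bullet> a) *\<^sub>R y) + d *\<^sub>R z"
        by (simp add: Z_def d_def transpose_add transpose_scaleR matrix_vector_mult_add_rdistrib
            scaleR_matrix_vector inner_diff_left)
      moreover have "(transpose (Z t) *v a) \<bullet> (S *v (transpose (Z t) *v a)) < a \<bullet> (P *v a)"
        using SQBP_block_diag_iff[OF P, of S] S sub ZQ[of t] a by (auto simp: psd_mats_def)
      \<comment> \<open>The correction along \<open>z\<close> is invisible to \<open>S\<close>.\<close>
      moreover have "(g + d *\<^sub>R z) \<bullet> (S *v (g + d *\<^sub>R z)) = g \<bullet> (S *v g)" for g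
        by (simp add: matrix_vector_right_distrib matrix_vector_mult_scaleR inner_add_left Sz zS)
      ultimately show "(transpose Z0 *v a + t *\<^sub>R ((a \<bullet> a) *\<^sub>R y)) \<bullet>
          (S *v (transpose Z0 *v a + t *\<^sub>R ((a \<bullet> a) *\<^sub>R y))) \<le> a \<bullet> (P *v a)"
        by simp
    qed
    then show ?thesis using a by (simp add: matrix_vector_mult_scaleR)
  qed
  then show ?thesis by (simp add: matrix_eq)
qed

text \<open>
  The strict version of the matrix S-lemma of van Waarde, Camlibel and Mesbahi, for a block diagonal
  right-hand side.  It is this block structure that keeps the equivalence true when $\ker N_{22}$ is
  not contained in $\ker N_{12}$, since the inclusion then forces $S = 0$.
\<close>

theorem strict_matrix_S_lemma:
  fixes N :: "real^('n::finite + 'k::finite)^('n + 'k)" and P :: "real^'n^'n" and S :: "real^'k^'k"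
  assumes N: "N \<in> sym_mats" and N22: "- block22 N \<in> psd_mats" and ne: "QBP N \<noteq> {}"
    and P: "P \<in> sym_mats" and S: "S \<in> psd_mats"
  shows "QBP N \<subseteq> SQBP (block_diag P (- S)) \<longleftrightarrow>
    (\<exists>\<alpha> \<beta>. \<alpha> \<ge> 0 \<and> \<beta> > 0 \<and> block_diag (P - \<beta> *\<^sub>R mat 1) (- S) - \<alpha> *\<^sub>R N \<in> psd_mats)"
proof -
  have Ssym: "S \<in> sym_mats" using S by (simp add: psd_mats_def)
  have form: "vjoin x y \<bullet> ((block_diag (P - \<beta> *\<^sub>R mat 1) (- S) - \<alpha> *\<^sub>R N) *v vjoin x y) =
      x \<bullet> (P *v x) - \<beta> * (x \<bullet> x) - y \<bullet> (S *v y) - \<alpha> * (vjoin x y \<bullet> (N *v vjoin x y))" for x y \<alpha> \<beta>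
    by (simp add: matrix_vector_mult_diff_rdistrib scaleR_matrix_vector inner_diff_right)
  have symm: "block_diag (P - \<beta> *\<^sub>R mat 1) (- S) - \<alpha> *\<^sub>R N \<in> sym_mats" for \<alpha> \<beta>
  proof -
    have "block_diag (P - \<beta> *\<^sub>R mat 1) (- S) \<in> sym_mats"
      using P Ssym by (intro sym_mats_block_diag)
        (auto simp: sym_mats_def transpose_def vec_eq_iff mat_def)
    then show ?thesis
      using N by (simp add: sym_mats_def transpose_def vec_eq_iff)
  qed
  have "\<exists>\<alpha> \<beta>. \<alpha> \<ge> 0 \<and> \<beta> > 0 \<and> (\<forall>x y. \<alpha> * (vjoin x y \<bullet> (N *v vjoin x y)) \<le>
      x \<bullet> (P *v x) - \<beta> * (x \<bullet> x) - y \<bullet> (S *v y))"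
    if sub: "QBP N \<subseteq> SQBP (block_diag P (- S))"
  proof (cases "\<forall>z. block22 N *v z = 0 \<longrightarrow> block12 N *v z = 0")
    case False
    obtain Z0 where Z0: "Z0 \<in> QBP N" using ne by blast
    have S0: "S = 0"
      using False degenerate_kernel_imp_zero[OF N N22 Z0 P S sub] by blast
    have "Z0 \<in> SQBP (block_diag P (- S))" using Z0 sub by blast
    then have "\<forall>x. x \<noteq> 0 \<longrightarrow> 0 < x \<bullet> (P *v x)"
      unfolding SQBP_block_diag_iff[OF P Ssym] by (simp add: S0)
    then have pos: "0 < x \<bullet> (P *v x)" if "x \<noteq> 0" for x
      using that by blast
    obtain \<beta> where "\<beta> > 0" "\<And>x. \<beta> * (x \<bullet> x) \<le> x \<bullet> (P *v x)"
      by (rule pos_def_on_subspace_bound[OF subspace_UNIV pos]) simp_all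
    then show ?thesis by (intro exI[of _ 0] exI[of _ \<beta>]) (simp add: S0)
  next
    case True
    then have ker: "block12 N *v z = 0" if "block22 N *v z = 0" for z using that by blast
    obtain Z0 where Z0: "Z0 \<in> QBP N" using ne by blast
    have Sker: "S *v z = 0" if z: "block22 N *v z = 0" for z
    proof -
      define \<xi> :: "real^'n" where "\<xi> = axis undefined 1"
      have \<xi>: "\<xi> \<noteq> 0" "\<xi> \<bullet> \<xi> \<noteq> 0" by (simp_all add: \<xi>_def axis_eq_0_iff)
      have "S *v ((\<xi> \<bullet> \<xi>) *\<^sub>R z) = 0"
      proof (rule QBP_ray_in_SQBP[OF P S sub \<xi>(1)])
        fix t :: real
        show "Z0 + rank_one (t *\<^sub>R \<xi>) z \<in> QBP N"
          by (rule QBP_recession_of_common_kernel[OF N Z0 z ker[OF z]])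
        show "transpose (Z0 + rank_one (t *\<^sub>R \<xi>) z) *v \<xi> = transpose Z0 *v \<xi> + t *\<^sub>R ((\<xi> \<bullet> \<xi>) *\<^sub>R z)"
          by (simp add: transpose_add matrix_vector_mult_add_rdistrib)
      qed
      then show ?thesis using \<xi> by (simp add: matrix_vector_mult_scaleR)
    qed
    \<comment> \<open>The scalar S-lemma needs strictness at every nonzero vector, which holds once the kernel
      of \<open>N22\<close> is split off.\<close>
    define K where "K = {z. block22 N *v z = 0}"
    have K: "span K = K"
      unfolding K_def span_eq_iff subspace_def
      by (simp add: matrix_vector_right_distrib matrix_vector_mult_scaleR)
    define V where "V = {v. \<forall>z\<in>K. v \<bullet> vjoin (0 :: real^'n) z = 0}"
    have V: "subspace V"
      by (simp add: subspace_def V_def inner_add_left)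
    have in_V: "vjoin x y \<in> V \<longleftrightarrow> (\<forall>z\<in>K. orthogonal y z)" for x y
      by (simp add: V_def orthogonal_def)
    have "0 < v \<bullet> (block_diag P (- S) *v v)"
      if v: "v \<in> V" "v \<noteq> 0" "0 \<le> v \<bullet> (N *v v)" for v
    proof -
      obtain x y where xy: "v = vjoin x y" "\<forall>z\<in>K. orthogonal y z"
        using v(1) in_V vjoin_exhaust by metis
      \<comment> \<open>Otherwise \<open>y\<close> would be both in the kernel of \<open>N22\<close> and orthogonal to it.\<close>
      have "x \<noteq> 0"
      proof
        assume "x = 0"
        then have "block22 N *v y = 0"
          using psd_kernel[OF N22, of y] v(3) by (simp add: xy(1) quadratic_form_vjoin[OF N])
        then have "y = 0" using xy(2) by (auto simp: K_def orthogonal_def)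
        then show False using v(2) \<open>x = 0\<close> xy(1) by simp
      qed
      obtain Z where "Z \<in> QBP N" "transpose Z *v x = y"
        using QBP_interpolation[OF N N22 ker Z0 \<open>x \<noteq> 0\<close>, of y] v(3) xy(1) by auto
      then show ?thesis
        using sub \<open>x \<noteq> 0\<close> SQBP_block_diag_iff[OF P Ssym] by (force simp: xy(1))
    qed
    then obtain \<alpha> where \<alpha>: "\<alpha> \<ge> 0"
      "\<And>v. v \<in> V \<Longrightarrow> v \<noteq> 0 \<Longrightarrow> 0 < v \<bullet> ((block_diag P (- S) - \<alpha> *\<^sub>R N) *v v)"
      using strict_S_lemma_on_subspace[OF V, of N "block_diag P (- S)"] by blast
    then obtain \<beta> where \<beta>: "\<beta> > 0"
      "\<And>v. v \<in> V \<Longrightarrow> \<beta> * (v \<bullet> v) \<le> v \<bullet> ((block_diag P (- S) - \<alpha> *\<^sub>R N) *v v)"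
      using pos_def_on_subspace_bound[OF V, of "block_diag P (- S) - \<alpha> *\<^sub>R N"] by blast
    \<comment> \<open>Components in the kernel change neither form, so the bound extends to all vectors.\<close>
    have "\<alpha> * (vjoin x y \<bullet> (N *v vjoin x y)) \<le> x \<bullet> (P *v x) - \<beta> * (x \<bullet> x) - y \<bullet> (S *v y)" for x y
    proof -
      obtain z w where "z \<in> K" and orth: "\<And>z'. z' \<in> K \<Longrightarrow> orthogonal w z'" and y: "y = z + w"
        using orthogonal_subspace_decomp_exists[of K y] unfolding K by blast
      have z: "block22 N *v z = 0" "block12 N *v z = 0" "S *v z = 0"
        using \<open>z \<in> K\<close> ker Sker by (auto simp: K_def)
      have zN: "z \<bullet> (block22 N *v w) = 0"
        using sym_mats_inner[OF sym_mats_block22[OF N], of z w] z by simp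
      have zS: "z \<bullet> (S *v w) = 0"
        using sym_mats_inner[OF Ssym, of z w] z by simp
      have "vjoin x y \<bullet> (N *v vjoin x y) = vjoin x w \<bullet> (N *v vjoin x w)"
        unfolding quadratic_form_vjoin[OF N] y
        by (simp add: matrix_vector_right_distrib inner_add_left z zN)
      moreover have "y \<bullet> (S *v y) = w \<bullet> (S *v w)"
        unfolding y by (simp add: matrix_vector_right_distrib inner_add_left z zS)
      moreover have "vjoin x w \<in> V" using orth by (simp add: in_V)
      from \<beta>(2)[OF this] have "\<beta> * (x \<bullet> x) + \<beta> * (w \<bullet> w) \<le>
          x \<bullet> (P *v x) - w \<bullet> (S *v w) - \<alpha> * (vjoin x w \<bullet> (N *v vjoin x w))"
        by (simp add: matrix_vector_mult_diff_rdistrib scaleR_matrix_vector inner_diff_right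
            distrib_left)
      moreover have "0 \<le> \<beta> * (w \<bullet> w)" using \<beta>(1) by simp
      ultimately show ?thesis by simp
    qed
    then show ?thesis using \<alpha>(1) \<beta>(1) by blast
  qed
  moreover have "QBP N \<subseteq> SQBP (block_diag P (- S))"
    if \<alpha>: "\<alpha> \<ge> 0" and \<beta>: "\<beta> > 0" and psd: "block_diag (P - \<beta> *\<^sub>R mat 1) (- S) - \<alpha> *\<^sub>R N \<in> psd_mats"
    for \<alpha> \<beta>
  proof
    fix Z assume Z: "Z \<in> QBP N"
    show "Z \<in> SQBP (block_diag P (- S))"
      unfolding SQBP_block_diag_iff[OF P Ssym]
    proof (intro allI impI)
      fix \<xi> :: "real^'n" assume "\<xi> \<noteq> 0"
      let ?y = "transpose Z *v \<xi>"
      have "0 \<le> \<xi> \<bullet> (P *v \<xi>) - \<beta> * (\<xi> \<bullet> \<xi>) - ?y \<bullet> (S *v ?y)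
          - \<alpha> * (vjoin \<xi> ?y \<bullet> (N *v vjoin \<xi> ?y))"
        using psd unfolding psd_mats_def form[symmetric] by blast
      moreover have "0 \<le> \<alpha> * (vjoin \<xi> ?y \<bullet> (N *v vjoin \<xi> ?y))"
        using Z \<alpha> unfolding QBP_iff[OF N] by simp
      moreover have "0 < \<beta> * (\<xi> \<bullet> \<xi>)" using \<beta> \<open>\<xi> \<noteq> 0\<close> by simp
      ultimately show "?y \<bullet> (S *v ?y) < \<xi> \<bullet> (P *v \<xi>)" by linarith
    qed
  qed
  moreover have "block_diag (P - \<beta> *\<^sub>R mat 1) (- S) - \<alpha> *\<^sub>R N \<in> psd_mats"
    if "\<forall>x y. \<alpha> * (vjoin x y \<bullet> (N *v vjoin x y)) \<le> x \<bullet> (P *v x) - \<beta> * (x \<bullet> x) - y \<bullet> (S *v y)"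
    for \<alpha> \<beta>
  proof -
    have "0 \<le> v \<bullet> ((block_diag (P - \<beta> *\<^sub>R mat 1) (- S) - \<alpha> *\<^sub>R N) *v v)" for v
    proof (cases v rule: vjoin_exhaust)
      case (1 x y)
      then show ?thesis using that by (simp only: form) (simp add: algebra_simps)
    qed
    then show ?thesis using symm by (simp add: psd_mats_def)
  qed
  ultimately show ?thesis by blast
qed

section \<open>Kronecker structure and the data equation\<close>

lemma vcat_mult: "vcat A B ** X = vcat (A ** X) (B ** X)"
  by (simp add: vec_eq_iff matrix_matrix_mult_def vcat_def split: sum.split)

lemma mult_hcat: "X ** hcat A B = hcat (X ** A) (X ** B)"
  by (simp add: vec_eq_iff matrix_matrix_mult_def hcat_def split: sum.split)

lemma hcat_mult_vcat: "hcat A B ** vcat C D = A ** C + B ** D"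
  by (simp add: vec_eq_iff matrix_matrix_mult_def hcat_def vcat_def sum_UNIV_Plus)

lemma vcat_hcat_zero: "vcat (hcat 0 A) (hcat 0 B) = hcat 0 (vcat A B)"
  by (simp add: vec_eq_iff hcat_def vcat_def split: sum.split)

lemma vcat_uminus: "vcat (- A) (- B) = - vcat A B"
  by (simp add: vec_eq_iff vcat_def split: sum.split)

lemma hcat_vcat: "hcat (vcat A B) (vcat C D) = vcat (hcat A C) (hcat B D)"
  by (simp add: vec_eq_iff hcat_def vcat_def split: sum.split)

lemma transpose_zero: "transpose 0 = (0 :: real^'r^'c)"
  by (simp add: vec_eq_iff transpose_def)

lemma hcat_zero_zero: "hcat 0 0 = 0"
  by (simp add: vec_eq_iff hcat_def split: sum.split)

lemma block3_eq_block_diag: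
  "block3 A 0 0 0 M22 M23 0 M32 M33 = block_diag A (vcat (hcat M22 M23) (hcat M32 M33))"
  by (simp add: block3_def block_diag_def hcat_zero_zero vcat_hcat_zero)

lemma kron_col_mult: "kron_col w X ** Y = kron_col w (X ** Y)"
  by (simp add: vec_eq_iff matrix_matrix_mult_def kron_col_def sum_distrib_left mult.assoc)

lemma mult_transpose_kron_col: "X ** transpose (kron_col w Y) = kron_row w (X ** transpose Y)"
  by (simp add: vec_eq_iff matrix_matrix_mult_def kron_col_def kron_row_def transpose_def
      sum_distrib_left mult_ac)

lemma kron_row_kron_col: "kron_row w (kron_col w X) = kron (outer w) X"
  by (simp add: vec_eq_iff kron_row_def kron_col_def kron_def outer_def matrix_matrix_mult_def
      columnvector_def rowvector_def mult_ac)

lemma kron_row_vcat: "kron_row w (vcat X Y) = vcat (kron_row w X) (kron_row w Y)"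
  by (simp add: vec_eq_iff kron_row_def vcat_def split: sum.split)

text \<open>
  The lower right part of the matrix of the claim factors through $P$: it is $-C P C^T$ with
  $C = [\omega \otimes I; K]$, so that $Z C = \sum_\ell \omega_\ell A_\ell + B K$ is the
  closed-loop matrix at the vertex.
\<close>

lemma kron_blocks_eq_congruence:
  fixes w :: "real^'l" and P :: "real^'n^'n" and K :: "real^'n^'m"
  shows "vcat (hcat (- kron (outer w) P) (- kron_col w (P ** transpose K)))
      (hcat (- kron_row w (K ** P)) (- (K ** P ** transpose K)))
    = - (vcat (kron_col w (mat 1)) K ** P ** transpose (vcat (kron_col w (mat 1)) K))"
    (is "?L = - ?R")
proof -
  have "?R = vcat (hcat (kron (outer w) P) (kron_col w (P ** transpose K)))
      (hcat (kron_row w (K ** P)) (K ** P ** transpose K))"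
    by (simp add: transpose_vcat vcat_mult mult_hcat kron_col_mult mult_transpose_kron_col
        kron_row_kron_col kron_row_vcat hcat_vcat transpose_mat)
  then show ?thesis
    by (simp add: vec_eq_iff vcat_def hcat_def split: sum.split)
qed

text \<open>
  Since $[I \; Z]\, G = [I \; X - Z D]$, the two quadratic matrix inequalities are literally the
  same.
\<close>

lemma QBP_congruence_iff:
  fixes \<Phi> :: "real^('n::finite + 't::finite)^('n + 't)" and Z :: "real^'k::finite^'n"
  assumes G: "G = vcat (hcat (mat 1) X) (hcat 0 (- D))"
  shows "X - Z ** D \<in> QBP \<Phi> \<longleftrightarrow> Z \<in> QBP (G ** \<Phi> ** transpose G)"
proof -
  have "transpose G ** vcat (mat 1) (transpose Z) = vcat (mat 1) (transpose (X - Z ** D))"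
  proof (unfold matrix_eq, intro allI)
    fix \<xi>
    have "transpose (X - Z ** D) = transpose X - transpose D ** transpose Z"
      by (simp add: matrix_transpose_mul[symmetric]) (simp add: vec_eq_iff transpose_def)
    moreover have "transpose (- D) = - transpose D" by (simp add: vec_eq_iff transpose_def)
    ultimately show "(transpose G ** vcat (mat 1) (transpose Z)) *v \<xi> =
        vcat (mat 1) (transpose (X - Z ** D)) *v \<xi>"
      by (simp add: G matrix_vector_mul_assoc[symmetric] transpose_vcat transpose_hcat transpose_mat transpose_zero
          matrix_vector_mult_diff_rdistrib vjoin_add)
  qed
  moreover from this have "transpose (vcat (mat 1) (transpose Z)) ** G
      = transpose (vcat (mat 1) (transpose (X - Z ** D)))"
    by (metis matrix_transpose_mul transpose_transpose)
  moreover have "transpose (vcat (mat 1) (transpose Z)) ** (G ** \<Phi> ** transpose G) ** vcat (mat 1) (transpose Z)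
      = (transpose (vcat (mat 1) (transpose Z)) ** G) ** \<Phi> ** (transpose G ** vcat (mat 1) (transpose Z))"
    by (simp only: matrix_mul_assoc)
  ultimately show ?thesis by (simp add: QBP_def)
qed

lemma congruence_block22_psd:
  fixes \<Phi> :: "real^('n::finite + 't::finite)^('n + 't)" and D :: "real^'t^'k::finite"
  assumes G: "G = vcat (hcat (mat 1) X) (hcat 0 (- D))"
    and \<Phi>: "\<Phi> \<in> sym_mats" "- block22 \<Phi> \<in> psd_mats"
  shows "G ** \<Phi> ** transpose G \<in> sym_mats" "- block22 (G ** \<Phi> ** transpose G) \<in> psd_mats"
proof -
  show sym: "G ** \<Phi> ** transpose G \<in> sym_mats"
    using transpose_congruence[OF \<Phi>(1), of "transpose G"] by simp
  have "y \<bullet> (block22 (G ** \<Phi> ** transpose G) *v y) \<le> 0" for y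
  proof -
    define w where "w = - (transpose D *v y)"
    have "transpose (- D) = - transpose D" by (simp add: vec_eq_iff transpose_def)
    then have "transpose G *v vjoin 0 y = vjoin 0 w"
      by (simp add: G w_def transpose_vcat transpose_hcat transpose_mat transpose_zero vjoin_add)
    then have "y \<bullet> (block22 (G ** \<Phi> ** transpose G) *v y) = w \<bullet> (block22 \<Phi> *v w)"
      using quadratic_form_congruence[of "vjoin 0 y" "transpose G" \<Phi>]
      by (simp add: quadratic_form_vjoin[OF sym] quadratic_form_vjoin[OF \<Phi>(1)])
    moreover have "0 \<le> w \<bullet> (- block22 \<Phi> *v w)" using \<Phi>(2) unfolding psd_mats_def by blast
    ultimately show ?thesis by simp
  qed
  then show "- block22 (G ** \<Phi> ** transpose G) \<in> psd_mats"
    using sym_mats_block22[OF sym] by (auto simp: psd_mats_def sym_mats_def transpose_def vec_eq_iff)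
qed

lemma discrepancy_matrix:
  "data_mat \<tau> (discrepancy x u \<theta> A B) = data_mat \<tau> (\<lambda>t. x (t + 1)) -
     plant_row A B ** vcat (khatri_rao (data_mat \<tau> \<theta>) (data_mat \<tau> x)) (data_mat \<tau> u)"
proof -
  have "(\<Sum>l\<in>UNIV. \<theta> t $ l *\<^sub>R (A l *v x t)) $ i
      = (\<Sum>p\<in>UNIV. A (fst p) $ i $ snd p * (\<theta> t $ fst p * x t $ snd p))" for t i
    by (simp add: matrix_vector_mult_def sum_distrib_left UNIV_Times_UNIV[symmetric]
        sum.cartesian_product' mult_ac del: UNIV_Times_UNIV)
  then show ?thesis
    unfolding plant_row_def hcat_mult_vcat
    by (simp add: vec_eq_iff data_mat_def discrepancy_def
        matrix_matrix_mult_def khatri_rao_def kron_vec_def transpose_def column_def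
        matrix_vector_mult_def)
qed

lemma plant_row_surj: obtains A B where "Z = plant_row A B"
proof
  show "Z = plant_row (\<lambda>l. \<chi> i j. Z $ i $ Inl (l, j)) (\<chi> i j. Z $ i $ Inr j)"
    by (simp add: plant_row_def hcat_def vec_eq_iff split: sum.split)
qed

section \<open>Robust quadratic boundedness from data\<close>

theorem theorem3p3:
  fixes \<omega> :: "nat \<Rightarrow> real^'l" and N\<^sub>v v :: nat and \<Theta> :: "(real^'l) set"
    and \<tau> :: "'t::finite \<Rightarrow> nat"
    and x :: "nat \<Rightarrow> real^'n" and u :: "nat \<Rightarrow> real^'m" and \<theta> :: "nat \<Rightarrow> real^'l"
    and \<Phi> :: "real^('n + 't)^('n + 't)"
    and A_true :: "'l \<Rightarrow> real^'n^'n" and B_true :: "real^'m^'n"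
    and P :: "real^'n^'n" and K :: "real^'n^'m"
  assumes "bij_betw \<tau> UNIV {0..<CARD('t)}"
    and "\<Theta> = convex hull (\<omega> ` {1..N\<^sub>v})" and "\<Theta> \<noteq> {}"
    and "\<And>t. t < CARD('t) \<Longrightarrow> \<theta> t \<in> \<Theta>"
    and "\<Phi> \<in> sym_mats" and "- block22 \<Phi> \<in> psd_mats"
    and "(A_true, B_true) \<in> consistent_plants \<tau> x u \<theta> \<Phi>"
    and "v \<in> {1..N\<^sub>v}" and "P \<in> pd_mats"
  shows "(\<forall>(A, B) \<in> consistent_plants \<tau> x u \<theta> \<Phi>.
            plant_row A B \<in> SQBP
              (block3
                P 0 0
                0 (- kron (outer (\<omega> v)) P) (- kron_col (\<omega> v) (P ** transpose K))
                0 (- kron_row (\<omega> v) (K ** P)) (- (K ** P ** transpose K))))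
         \<longleftrightarrow>
         (\<exists>\<alpha> \<beta>. \<alpha> \<ge> 0 \<and> \<beta> > 0 \<and>
            block3
              (P - \<beta> *\<^sub>R mat 1) 0 0
              0 (- kron (outer (\<omega> v)) P) (- kron_col (\<omega> v) (P ** transpose K))
              0 (- kron_row (\<omega> v) (K ** P)) (- (K ** P ** transpose K))
            - \<alpha> *\<^sub>R data_Psi \<tau> x u \<theta> \<Phi> \<in> psd_mats)"
proof -
  define D where "D = vcat (khatri_rao (data_mat \<tau> \<theta>) (data_mat \<tau> x)) (data_mat \<tau> u)"
  define X where "X = data_mat \<tau> (\<lambda>t. x (t + 1))"
  define N where "N = data_Psi \<tau> x u \<theta> \<Phi>"
  define S where "S = vcat (kron_col (\<omega> v) (mat 1)) K ** P ** transpose (vcat (kron_col (\<omega> v) (mat 1)) K)"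
  have G: "data_G \<tau> x u \<theta> = vcat (hcat (mat 1) X) (hcat 0 (- D))"
    by (simp add: data_G_def X_def D_def vcat_hcat_zero vcat_uminus)
  have consistent: "(A, B) \<in> consistent_plants \<tau> x u \<theta> \<Phi> \<longleftrightarrow> plant_row A B \<in> QBP N" for A B
    using QBP_congruence_iff[OF G, of "plant_row A B" \<Phi>]
    by (simp add: consistent_plants_def discrepancy_matrix N_def data_Psi_def X_def D_def)
  have N: "N \<in> sym_mats" "- block22 N \<in> psd_mats"
    using congruence_block22_psd[OF G \<open>\<Phi> \<in> sym_mats\<close> \<open>- block22 \<Phi> \<in> psd_mats\<close>]
    by (simp_all add: N_def data_Psi_def)
  have "QBP N \<noteq> {}"
    using consistent \<open>(A_true, B_true) \<in> _\<close> by blast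
  have P: "P \<in> sym_mats" "P \<in> psd_mats"
    using \<open>P \<in> pd_mats\<close> by (auto simp: pd_mats_def psd_mats_def less_le) (metis inner_zero_left order_refl)
  have S: "S \<in> psd_mats"
    unfolding S_def by (rule psd_congruence[OF P(2)])
  have "(\<forall>(A, B) \<in> consistent_plants \<tau> x u \<theta> \<Phi>. plant_row A B \<in> Q) \<longleftrightarrow> QBP N \<subseteq> Q" for Q
  proof -
    have "Z \<in> Q" if "\<forall>(A, B) \<in> consistent_plants \<tau> x u \<theta> \<Phi>. plant_row A B \<in> Q" "Z \<in> QBP N" for Z
      using that consistent by (cases Z rule: plant_row_surj) blast
    then show ?thesis using consistent by blast
  qed
  then show ?thesis
    unfolding block3_eq_block_diag kron_blocks_eq_congruence S_def[symmetric] N_def[symmetric]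
    using strict_matrix_S_lemma[OF N \<open>QBP N \<noteq> {}\<close> P(1) S] by simp
qed
end
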